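(* There is an algorithm that, given as input a positive integer $N$, always terminates, and at termination either produces a solution $(M,s)$ with $s$ rational of the equation $$\frac{N}{M^2}=\frac{(2-s^2)(3-s^2)}{(1-s)^2(2+s)^2},$$ or reports that no such solution exists.
   Context: A solution of this equation means a pair $(M,s)$ with $M$ a positive integer and $s$ a number strictly between $0$ and $1$. *)

theory Defs
  imports Complex_Main "HOL-Library.Countable"
begin

text \<open>
  Algorithms are modelled by the partial (mu-)recursive functions. A program carries no arity; it is
  run on a list of arguments, and has no result if the list has an unsuitable length or if a
  minimisation diverges.
\<close>

datatype recf =
    Zero
  | Succ
  | Proj nat
  | Comp recf "recf list"
  | Prim recf recf
  | Mini recf

text \<open>
  \<open>computes P xs y\<close>: program \<open>P\<close> terminates on input \<open>xs\<close> with result \<open>y\<close>.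
  The recursion argument of \<open>Prim\<close> and the search variable of \<open>Mini\<close> come first; the step
  function of \<open>Prim\<close> receives the counter, the previous value and then the parameters. In
  \<open>computes_Mini\<close> the values below the least root have to be defined.
\<close>

inductive computes :: "recf \<Rightarrow> nat list \<Rightarrow> nat \<Rightarrow> bool" where
  computes_Zero: "computes Zero xs 0"
| computes_Succ: "computes Succ [x] (Suc x)"
| computes_Proj: "i < length xs \<Longrightarrow> computes (Proj i) xs (xs ! i)"
| computes_Comp: "list_all2 (\<lambda>g y. computes g xs y) gs ys \<Longrightarrow> computes f ys z \<Longrightarrow>
    computes (Comp f gs) xs z"
| computes_Prim_0: "computes f xs y \<Longrightarrow> computes (Prim f g) (0 # xs) y"
| computes_Prim_Suc: "computes (Prim f g) (n # xs) r \<Longrightarrow> computes g (n # r # xs) y \<Longrightarrow>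
    computes (Prim f g) (Suc n # xs) y"
| computes_Mini: "computes f (n # xs) 0 \<Longrightarrow> (\<And>m. m < n \<Longrightarrow> \<exists>y. computes f (m # xs) (Suc y)) \<Longrightarrow>
    computes (Mini f) xs n"

inductive_cases computes_ZeroE: "computes Zero xs z"
inductive_cases computes_SuccE: "computes Succ xs z"
inductive_cases computes_ProjE: "computes (Proj i) xs z"
inductive_cases computes_CompE: "computes (Comp f gs) xs z"
inductive_cases computes_Prim_0E: "computes (Prim f g) (0 # xs) z"
inductive_cases computes_Prim_SucE: "computes (Prim f g) (Suc n # xs) z"
inductive_cases computes_MiniE: "computes (Mini f) xs z"

lemma computes_deterministic: "computes P xs y \<Longrightarrow> computes P xs z \<Longrightarrow> y = z"
proof (induction arbitrary: z rule: computes.induct)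
  case (computes_Zero xs)
  then show ?case by (rule computes_ZeroE) simp
next
  case (computes_Succ x)
  then show ?case by (rule computes_SuccE) simp
next
  case (computes_Proj i xs)
  from computes_Proj(2) show ?case by (rule computes_ProjE) simp
next
  case (computes_Comp xs gs ys f w)
  from computes_Comp.prems obtain ys'
    where ys': "list_all2 (\<lambda>g y. computes g xs y) gs ys'" "computes f ys' z"
    by (rule computes_CompE)
  have "ys = ys'"
  proof (rule nth_equalityI)
    show "length ys = length ys'"
      using list_all2_lengthD[OF computes_Comp.IH(1)] list_all2_lengthD[OF ys'(1)] by simp
    show "ys ! i = ys' ! i" if "i < length ys" for i
    proof -
      have i: "i < length gs"
        using that list_all2_lengthD[OF computes_Comp.IH(1)] by simp
      show ?thesis
        using list_all2_nthD[OF computes_Comp.IH(1) i] list_all2_nthD[OF ys'(1) i] by blast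
    qed
  qed
  then show ?case using computes_Comp.IH(2) ys'(2) by blast
next
  case (computes_Prim_0 f xs y g)
  from computes_Prim_0.prems have "computes f xs z" by (rule computes_Prim_0E)
  then show ?case by (rule computes_Prim_0.IH)
next
  case (computes_Prim_Suc f g n xs r y)
  from computes_Prim_Suc.prems obtain r'
    where r': "computes (Prim f g) (n # xs) r'" "computes g (n # r' # xs) z"
    by (rule computes_Prim_SucE)
  have "r = r'" using r'(1) by (rule computes_Prim_Suc.IH(1))
  with r'(2) show ?case by (intro computes_Prim_Suc.IH(2)) simp
next
  case (computes_Mini f n xs)
  from computes_Mini.prems
  have z: "computes f (z # xs) 0 \<and> (\<forall>m < z. \<exists>y. computes f (m # xs) (Suc y))"
    by (rule computes_MiniE) blast
  have "\<not> n < z"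
  proof
    assume "n < z"
    then obtain y where "computes f (n # xs) (Suc y)" using z by blast
    then have "0 = Suc y" by (rule computes_Mini.IH(1))
    then show False by simp
  qed
  moreover have "\<not> z < n"
  proof
    assume "z < n"
    then obtain y where "\<And>v. computes f (z # xs) v \<Longrightarrow> Suc y = v"
      using computes_Mini.IH(2) by blast
    then have "Suc y = 0" using z by blast
    then show False by simp
  qed
  ultimately show ?case by simp
qed

definition solution :: "nat \<Rightarrow> nat \<Rightarrow> real \<Rightarrow> bool" where
  "solution N M s \<longleftrightarrow> M > 0 \<and> 0 < s \<and> s < 1 \<and>
     real N / (real M)^2 = ((2 - s^2) * (3 - s^2)) / ((1 - s)^2 * (2 + s)^2)"

text \<open>
  The output is one natural number: \<open>0\<close> is the report ``no solution exists'', and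
  \<open>Suc k\<close> announces the pair \<open>(M, s)\<close>, where \<open>k\<close> is the code of \<open>M\<close> paired with a code of
  \<open>s\<close> as an integer fraction (a fraction with denominator \<open>0\<close> stands for \<open>0\<close>).
\<close>

fun decode_output :: "nat \<Rightarrow> (nat \<times> rat) option" where
  "decode_output 0 = None"
| "decode_output (Suc k) = (case prod_decode k of (M, c) \<Rightarrow> Some (M, nat_to_rat_surj c))"

end

theory Submission
  imports Defs
begin

text \<open>
  Write \<open>s = p / q\<close> in lowest terms. The equation becomes
  \<open>N (q - p)\<^sup>2 (2 q + p)\<^sup>2 = M\<^sup>2 D (D + q\<^sup>2)\<close> with \<open>D = 2 q\<^sup>2 - p\<^sup>2\<close>. Modulo \<open>D\<close> one has
  \<open>(q - p) (q + p) = - q\<^sup>2\<close> and \<open>(2 q + p) (2 q - p) = 2 q\<^sup>2\<close>, so \<open>D\<close> divides \<open>4 N q\<^sup>8\<close>;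
  as \<open>D\<close> is coprime to \<open>q\<close>, it divides \<open>4 N\<close>, and \<open>q\<^sup>2 < D\<close> bounds \<open>q\<close>. Moreover
  \<open>(q - p) (2 q + p) \<le> D\<close> gives \<open>M\<^sup>2 \<le> N\<close>. So a finite search, which is primitive recursive,
  decides the question.
\<close>

section \<open>Computable functions\<close>

text \<open>One program has to serve all inputs of length \<open>n\<close>. What \<open>f\<close>
  does on other lengths is left open, so \<open>computable_cong\<close> compares functions on length
  \<open>n\<close> only.\<close>

definition computable :: "nat \<Rightarrow> (nat list \<Rightarrow> nat) \<Rightarrow> bool" where
  "computable n f \<longleftrightarrow> (\<exists>P. \<forall>xs. length xs = n \<longrightarrow> computes P xs (f xs))"

section \<open>Closure under composition and primitive recursion\<close>

lemma computable_cong: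
  assumes "computable n f" and "\<And>xs. length xs = n \<Longrightarrow> f xs = g xs"
  shows "computable n g"
  using assms unfolding computable_def by metis

lemma computable_nth: "i < n \<Longrightarrow> computable n (\<lambda>xs. xs ! i)"
  unfolding computable_def by (metis computes_Proj)

lemma computable_comp:
  assumes h: "computable (length fs) h" and fs: "\<And>f. f \<in> set fs \<Longrightarrow> computable n f"
  shows "computable n (\<lambda>xs. h (map (\<lambda>f. f xs) fs))"
proof -
  obtain P where P: "\<And>ys. length ys = length fs \<Longrightarrow> computes P ys (h ys)"
    using h unfolding computable_def by blast
  have "\<forall>f\<in>set fs. \<exists>Q. \<forall>xs. length xs = n \<longrightarrow> computes Q xs (f xs)"
    using fs unfolding computable_def by blast
  then obtain Q where Q: "\<And>f xs. f \<in> set fs \<Longrightarrow> length xs = n \<Longrightarrow> computes (Q f) xs (f xs)"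
    by metis
  have "computes (Comp P (map Q fs)) xs (h (map (\<lambda>f. f xs) fs))" if "length xs = n" for xs
  proof (rule computes_Comp)
    show "list_all2 (\<lambda>g. computes g xs) (map Q fs) (map (\<lambda>f. f xs) fs)"
      using Q that by (simp add: list_all2_map1 list_all2_map2 list.rel_refl_strong)
  qed (simp add: P)
  then show ?thesis unfolding computable_def by blast
qed

lemma computable_comp1:
  assumes "computable 1 (\<lambda>ys. h (ys ! 0))" and "computable n f"
  shows "computable n (\<lambda>xs. h (f xs))"
  using computable_comp[of "[f]" "\<lambda>ys. h (ys ! 0)" n] assms by simp

lemma computable_comp2:
  assumes "computable 2 (\<lambda>ys. h (ys ! 0) (ys ! 1))" and "computable n f" and "computable n g"
  shows "computable n (\<lambda>xs. h (f xs) (g xs))"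
  using computable_comp[of "[f, g]" "\<lambda>ys. h (ys ! 0) (ys ! 1)" n] assms
  by (auto simp: numeral_2_eq_2)

lemma computable_comp3:
  assumes "computable 3 (\<lambda>ys. h (ys ! 0) (ys ! 1) (ys ! 2))"
    and "computable n f" and "computable n g" and "computable n k"
  shows "computable n (\<lambda>xs. h (f xs) (g xs) (k xs))"
  using computable_comp[of "[f, g, k]" "\<lambda>ys. h (ys ! 0) (ys ! 1) (ys ! 2)" n] assms
  by (auto simp: numeral_2_eq_2 numeral_3_eq_3)

text \<open>Composition with projections selects, permutes or drops arguments; this adapts a
  function to the longer argument list of a \<open>Prim\<close> step.\<close>

lemma computable_reindex:
  assumes "computable (length is) f" and "\<And>i. i \<in> set is \<Longrightarrow> i < n"
  shows "computable n (\<lambda>xs. f (map ((!) xs) is))"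
proof -
  have "computable n g" if "g \<in> set (map (\<lambda>i xs. xs ! i) is)" for g
    using that assms(2) by (auto intro: computable_nth)
  then show ?thesis
    using computable_comp[of "map (\<lambda>i xs. xs ! i) is" f n] assms(1) by (simp add: comp_def)
qed

lemma computable_Suc:
  assumes "computable n f"
  shows "computable n (\<lambda>xs. Suc (f xs))"
proof (rule computable_comp1[OF _ assms])
  have "computes Succ xs (Suc (xs ! 0))" if "length xs = 1" for xs
    using that computes_Succ[of "xs ! 0"] by (cases xs) auto
  then show "computable 1 (\<lambda>ys. Suc (ys ! 0))" unfolding computable_def by blast
qed

lemma computable_const: "computable n (\<lambda>_. c)"
proof (induction c)
  case 0
  show ?case unfolding computable_def by (metis computes_Zero)
next
  case (Suc c)
  then show ?case by (rule computable_Suc)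
qed

text \<open>\<open>Prim\<close> recurses on its first argument only. Composing it with
  \<open>b\<close> and projections lets the recursion depth depend on the parameters.\<close>

lemma computable_rec_nat:
  assumes f: "computable n f" and g: "computable (Suc (Suc n)) g" and b: "computable n b"
  shows "computable n (\<lambda>xs. rec_nat (f xs) (\<lambda>i r. g (i # r # xs)) (b xs))"
proof -
  let ?h = "\<lambda>ys. rec_nat (f (tl ys)) (\<lambda>i r. g (i # r # tl ys)) (hd ys)"
  obtain F G where F: "\<And>xs. length xs = n \<Longrightarrow> computes F xs (f xs)"
    and G: "\<And>xs. length xs = Suc (Suc n) \<Longrightarrow> computes G xs (g xs)"
    using f g unfolding computable_def by blast
  have "computes (Prim F G) (k # xs) (rec_nat (f xs) (\<lambda>i r. g (i # r # xs)) k)"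
    if xs: "length xs = n" for k xs
  proof (induction k)
    case 0
    show ?case using F[OF xs] by (simp add: computes_Prim_0)
  next
    case (Suc k)
    show ?case using computes_Prim_Suc[OF Suc.IH G] xs by simp
  qed
  then have "computes (Prim F G) ys (?h ys)" if "length ys = Suc n" for ys
    using that by (cases ys) auto
  then have "computable (Suc n) ?h" unfolding computable_def by blast
  \<comment> \<open>The \<open>n\<close> projections copy \<open>xs\<close> behind
    \<open>b xs\<close>, so \<open>?h\<close> receives \<open>b xs # xs\<close>.\<close>
  then have "computable n (\<lambda>xs. ?h (map (\<lambda>f. f xs) (b # map (\<lambda>i xs. xs ! i) [0..<n])))"
    by (intro computable_comp) (auto simp: b computable_nth)
  then show ?thesis
    by (rule computable_cong) (auto simp: comp_def map_nth)
qed

section \<open>Arithmetic and case distinctions\<close>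

lemma computable_add:
  assumes "computable n f" and "computable n g"
  shows "computable n (\<lambda>xs. f xs + g xs)"
proof (rule computable_cong)
  \<comment> \<open>In \<open>i # r # xs\<close>, here and below, index 0 is the counter, index 1
    the previous value, and index \<open>k + 2\<close> the parameter \<open>xs ! k\<close>.\<close>
  show "computable n (\<lambda>xs. rec_nat (f xs) (\<lambda>i r. Suc ((i # r # xs) ! 1)) (g xs))"
    by (rule computable_rec_nat[where g = "\<lambda>ys. Suc (ys ! 1)"])
      (auto intro!: assms computable_Suc computable_nth)
  have "rec_nat a (\<lambda>i r. Suc ((i # r # xs) ! 1)) b = a + b" for a b and xs :: "nat list"
    by (induction b) auto
  then show "rec_nat (f xs) (\<lambda>i r. Suc ((i # r # xs) ! 1)) (g xs) = f xs + g xs" for xs .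
qed

lemma computable_mult:
  assumes "computable n f" and "computable n g"
  shows "computable n (\<lambda>xs. f xs * g xs)"
proof (rule computable_comp2[OF computable_cong assms])
  show "computable 2
      (\<lambda>xs. rec_nat 0 (\<lambda>i r. (i # r # xs) ! 1 + (i # r # xs) ! 3) (xs ! 0))"
    by (rule computable_rec_nat[where g = "\<lambda>ys. ys ! 1 + ys ! 3"])
      (auto intro!: computable_const computable_add computable_nth)
  have "rec_nat 0 (\<lambda>i r. (i # r # xs) ! 1 + (i # r # xs) ! 3) b = b * xs ! 1"
    for b and xs :: "nat list"
    by (induction b) (auto simp: numeral_3_eq_3)
  then show "rec_nat 0 (\<lambda>i r. (i # r # xs) ! 1 + (i # r # xs) ! 3) (xs ! 0) = xs ! 0 * xs ! 1"
    for xs :: "nat list" .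
qed

lemma computable_pred:
  assumes "computable n f"
  shows "computable n (\<lambda>xs. f xs - 1)"
proof (rule computable_cong)
  show "computable n (\<lambda>xs. rec_nat 0 (\<lambda>i r. (i # r # xs) ! 0) (f xs))"
    by (rule computable_rec_nat[where g = "\<lambda>ys. ys ! 0"])
      (auto intro!: assms computable_const computable_nth)
  show "rec_nat 0 (\<lambda>i r. (i # r # xs) ! 0) (f xs) = f xs - 1" for xs
    by (cases "f xs") auto
qed

lemma computable_diff:
  assumes "computable n f" and "computable n g"
  shows "computable n (\<lambda>xs. f xs - g xs)"
proof (rule computable_cong)
  show "computable n (\<lambda>xs. rec_nat (f xs) (\<lambda>i r. (i # r # xs) ! 1 - 1) (g xs))"
    by (rule computable_rec_nat[where g = "\<lambda>ys. ys ! 1 - 1"])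
      (auto intro!: assms computable_pred[simplified] computable_nth)
  have "rec_nat a (\<lambda>i r. (i # r # xs) ! 1 - 1) b = a - b" for a b and xs :: "nat list"
    by (induction b) auto
  then show "rec_nat (f xs) (\<lambda>i r. (i # r # xs) ! 1 - 1) (g xs) = f xs - g xs" for xs .
qed

lemma computable_if_zero:
  assumes "computable n c" and "computable n f" and "computable n g"
  shows "computable n (\<lambda>xs. if c xs = 0 then f xs else g xs)"
proof (rule computable_comp3[where h = "\<lambda>x y z. if x = 0 then y else z", OF computable_cong assms])
  show "computable 3 (\<lambda>xs. rec_nat (xs ! 1) (\<lambda>i r. (i # r # xs) ! 4) (xs ! 0))"
    by (rule computable_rec_nat[where g = "\<lambda>ys. ys ! 4"])
      (auto intro!: computable_nth)
  have "(i # r # xs) ! 4 = xs ! 2" for i r and xs :: "nat list"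
    by (simp add: eval_nat_numeral)
  then show "rec_nat (xs ! 1) (\<lambda>i r. (i # r # xs) ! 4) (xs ! 0)
      = (if xs ! 0 = 0 then xs ! 1 else xs ! 2)" for xs :: "nat list"
    by (cases "xs ! 0") auto
qed

lemma computable_if_eq:
  assumes "computable n f" and "computable n g" and "computable n h" and "computable n k"
  shows "computable n (\<lambda>xs. if f xs = g xs then h xs else k xs)"
proof (rule computable_cong)
  \<comment> \<open>With truncated subtraction this sum is the distance of \<open>f xs\<close> and
    \<open>g xs\<close>.\<close>
  show "computable n (\<lambda>xs. if (f xs - g xs) + (g xs - f xs) = 0 then h xs else k xs)"
    by (intro computable_if_zero computable_add computable_diff assms)
qed auto

section \<open>Pairing and bounded search\<close>

lemma computable_triangle:
  assumes "computable n f"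
  shows "computable n (\<lambda>xs. triangle (f xs))"
proof (rule computable_cong)
  show "computable n
      (\<lambda>xs. rec_nat 0 (\<lambda>i r. (i # r # xs) ! 1 + Suc ((i # r # xs) ! 0)) (f xs))"
    by (rule computable_rec_nat[where g = "\<lambda>ys. ys ! 1 + Suc (ys ! 0)"])
      (auto intro!: assms computable_const computable_add computable_Suc computable_nth)
  have "rec_nat 0 (\<lambda>i r. (i # r # xs) ! 1 + Suc ((i # r # xs) ! 0)) b = triangle b"
    for b and xs :: "nat list"
    by (induction b) auto
  then show "rec_nat 0 (\<lambda>i r. (i # r # xs) ! 1 + Suc ((i # r # xs) ! 0)) (f xs)
      = triangle (f xs)" for xs .
qed

lemma computable_prod_encode:
  assumes "computable n f" and "computable n g"
  shows "computable n (\<lambda>xs. prod_encode (f xs, g xs))"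
  \<comment> \<open>Cantor pairing sends \<open>(m, n)\<close> to
    \<open>triangle (m + n) + m\<close>.\<close>
  unfolding prod_encode_def by (simp add: assms computable_add computable_triangle)

text \<open>Returning the value found rather than its index lets searches be nested: an inner
  failure is 0, which the outer search skips. A final 0 is already the report that no solution
  exists.\<close>

primrec first_nonzero :: "(nat \<Rightarrow> nat) \<Rightarrow> nat \<Rightarrow> nat" where
  "first_nonzero f 0 = 0"
| "first_nonzero f (Suc b) = (if first_nonzero f b = 0 then f b else first_nonzero f b)"

lemma first_nonzero_eq_0_iff: "first_nonzero f b = 0 \<longleftrightarrow> (\<forall>i<b. f i = 0)"
  by (induction b) (auto simp: less_Suc_eq)

lemma first_nonzero_eqD: "first_nonzero f b = Suc k \<Longrightarrow> \<exists>i<b. f i = Suc k"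
  by (induction b) (auto simp: less_Suc_eq split: if_splits)

lemma computable_first_nonzero:
  assumes f: "computable (Suc n) f" and b: "computable n b"
  shows "computable n (\<lambda>xs. first_nonzero (\<lambda>i. f (i # xs)) (b xs))"
proof (rule computable_cong)
  \<comment> \<open>The index list omits 1, hiding the previous value from \<open>f\<close>.\<close>
  let ?g = "\<lambda>ys. if ys ! 1 = 0 then f (map ((!) ys) (0 # [2..<Suc (Suc n)])) else ys ! 1"
  show "computable n (\<lambda>xs. rec_nat 0 (\<lambda>i r. ?g (i # r # xs)) (b xs))"
  proof (rule computable_rec_nat[where g = ?g, OF computable_const _ b])
    have "computable (Suc (Suc n)) (\<lambda>ys. f (map ((!) ys) (0 # [2..<Suc (Suc n)])))"
      using f by (intro computable_reindex) (auto simp del: upt_Suc)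
    then show "computable (Suc (Suc n)) ?g"
      by (intro computable_if_zero computable_nth) auto
  qed
  have drop2: "map ((!) (i # r # xs)) (0 # [2..<Suc (Suc n)]) = i # xs"
    if "length xs = n" for i r and xs :: "nat list"
    using that by (auto intro!: nth_equalityI simp: nth_Cons' simp del: upt_Suc)
  have "rec_nat 0 (\<lambda>i r. ?g (i # r # xs)) k = first_nonzero (\<lambda>i. f (i # xs)) k"
    if "length xs = n" for k xs
    unfolding drop2[OF that] by (induction k) auto
  then show "rec_nat 0 (\<lambda>i r. ?g (i # r # xs)) (b xs) = first_nonzero (\<lambda>i. f (i # xs)) (b xs)"
    if "length xs = n" for xs
    using that .
qed

section \<open>Bounding the solutions\<close>

definition solution_eq :: "nat \<Rightarrow> nat \<Rightarrow> nat \<Rightarrow> nat \<Rightarrow> bool" where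
  "solution_eq N M p a \<longleftrightarrow>
     N * ((a * (3 * p + 2 * a)) * (a * (3 * p + 2 * a))) =
     M * M * (((p + a) * (p + a) + a * (2 * p + a)) *
       (2 * ((p + a) * (p + a)) + a * (2 * p + a)))"

text \<open>The denominator is \<open>q = p + a\<close>, which keeps every term free of subtraction.\<close>

lemma solution_iff_solution_eq:
  assumes "p > 0" and "a > 0" and "M > 0"
  shows "solution N M (real p / real (p + a)) \<longleftrightarrow> solution_eq N M p a"
proof -
  define P A Q where "P = real p" and "A = real a" and "Q = P + A"
  have pos: "P > 0" "A > 0" "Q > 0" "real M > 0"
    using assms by (auto simp: P_def A_def Q_def)
  \<comment> \<open>Since \<open>A * (2 * P + A)\<close> is \<open>Q^2 - P^2\<close>, this is
    \<open>2 * Q^2 - P^2\<close> in visibly positive form; likewise \<open>B\<close> is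
    \<open>2 * Q + P\<close>.\<close>
  define D where "D = Q * Q + A * (2 * P + A)"
  define B where "B = 3 * P + 2 * A"
  have eqs: "1 - P / Q = A / Q" "2 + P / Q = B / Q" "2 - (P / Q)^2 = D / Q^2"
    "3 - (P / Q)^2 = (Q * Q + D) / Q^2"
  proof -
    have "A = Q - P" "B = 2 * Q + P" "D = 2 * Q^2 - P^2"
      by (auto simp: A_def B_def D_def Q_def power2_eq_square algebra_simps)
    then show "1 - P / Q = A / Q" "2 + P / Q = B / Q" "2 - (P / Q)^2 = D / Q^2"
      "3 - (P / Q)^2 = (Q * Q + D) / Q^2"
      using pos(3) by (auto simp: field_simps power2_eq_square)
  qed
  have "A > 0" "B > 0" "D > 0" using pos by (auto simp: B_def D_def intro!: add_pos_pos)
  have "solution N M (P / Q) \<longleftrightarrow>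
      real N / (real M)^2 = (D / Q^2 * ((Q * Q + D) / Q^2)) / ((A / Q)^2 * (B / Q)^2)"
    unfolding solution_def eqs using pos by (simp add: Q_def)
  also have "(D / Q^2 * ((Q * Q + D) / Q^2)) / ((A / Q)^2 * (B / Q)^2)
      = D * (Q * Q + D) / (A * B)^2"
    using pos \<open>B > 0\<close> by (simp add: field_simps power2_eq_square)
  also have "real N / (real M)^2 = D * (Q * Q + D) / (A * B)^2 \<longleftrightarrow>
      real N * ((A * B) * (A * B)) = real M * real M * (D * (Q * Q + D))"
    using pos \<open>B > 0\<close> by (simp add: field_simps power2_eq_square)
  also have "\<dots> \<longleftrightarrow> solution_eq N M p a"
    unfolding solution_eq_def of_nat_eq_iff[where 'a = real, symmetric]
    by (simp add: P_def A_def Q_def B_def D_def algebra_simps)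
  finally show ?thesis by (simp add: P_def A_def Q_def)
qed

lemma solution_eq_denominator_dvd:
  assumes "coprime p a" and "solution_eq N M p a"
  shows "(p + a) * (p + a) + a * (2 * p + a) dvd 4 * N"
proof -
  \<comment> \<open>The conjugate factors and the remainder below involve subtraction, hence the
    passage to integers.\<close>
  define P A Q where "P = int p" and "A = int a" and "Q = P + A"
  define D where "D = Q * Q + A * (2 * P + A)"
  have "int N * ((A * (3 * P + 2 * A)) * (A * (3 * P + 2 * A))) = int M * int M * (D * (Q * Q + D))"
    using arg_cong[OF assms(2)[unfolded solution_eq_def], of int]
    by (simp add: P_def A_def Q_def D_def algebra_simps)
  then have "D dvd int N * (A * (3 * P + 2 * A))^2"
    by (simp add: power2_eq_square)
  \<comment> \<open>The factors are conjugate to \<open>A = Q - P\<close> and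
    \<open>3 * P + 2 * A = 2 * Q + P\<close>; the products are \<open>Q^2 - P^2 = D - Q^2\<close>
    and \<open>4 * Q^2 - P^2 = D + 2 * Q^2\<close>.\<close>
  then have "D dvd int N * (A * (3 * P + 2 * A))^2 * ((Q + P) * (2 * Q - P))^2"
    by (rule dvd_mult2)
  also have "\<dots> = int N * ((D - Q * Q) * (D + 2 * (Q * Q)))^2"
    unfolding power_mult_distrib[symmetric] mult.assoc
    by (simp add: D_def Q_def algebra_simps)
  \<comment> \<open>With \<open>X = D * (D + Q^2)\<close> the squared product is
    \<open>(X - 2 * Q^4)^2 = X * (X - 4 * Q^4) + 4 * Q^8\<close>.\<close>
  also have "\<dots> = D * (int N * (D + Q * Q) * (D * (D + Q * Q) - 4 * Q^4)) + 4 * int N * Q^8"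
    by (simp add: algebra_simps eval_nat_numeral)
  finally have "D dvd 4 * int N * Q^8"
    by (simp add: dvd_add_right_iff)
  moreover have "coprime D (Q^8)"
  proof -
    have "coprime P Q"
      using assms(1) by (simp add: P_def A_def Q_def coprime_iff_gcd_eq_1)
    then have "coprime (P * P) Q" by simp
    \<comment> \<open>Modulo \<open>Q\<close>, \<open>D\<close> is \<open>- P^2\<close>, so it
      inherits coprimality from \<open>P\<close>.\<close>
    moreover have "D = 2 * Q * Q + (-1) * (P * P)"
      by (simp add: D_def Q_def algebra_simps)
    ultimately have "coprime D Q"
      by (metis (no_types, opaque_lifting) coprime_iff_gcd_eq_1 gcd.commute gcd_add_mult gcd_neg2
          mult.commute mult_minus1 add.commute)
    then show ?thesis by simp
  qed
  ultimately have "D dvd 4 * int N"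
    by (simp add: coprime_dvd_mult_left_iff)
  moreover have "D = int ((p + a) * (p + a) + a * (2 * p + a))"
    by (simp add: D_def P_def A_def Q_def)
  ultimately show ?thesis
    by (metis int_dvd_int_iff of_nat_mult of_nat_numeral)
qed

lemma solution_eq_bounds:
  assumes "N > 0" and "a > 0" and "coprime p a" and "solution_eq N M p a"
  shows "p + a \<le> 4 * N" and "M \<le> N"
proof -
  let ?D = "(p + a) * (p + a) + a * (2 * p + a)"
  have "p + a \<le> (p + a) * (p + a)" using \<open>a > 0\<close> by simp
  also have "\<dots> \<le> ?D" by simp
  also have "\<dots> \<le> 4 * N"
    using solution_eq_denominator_dvd[OF assms(3,4)] \<open>N > 0\<close> by (simp add: dvd_imp_le)
  finally show "p + a \<le> 4 * N" .
  let ?E = "2 * ((p + a) * (p + a)) + a * (2 * p + a)"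
  have "M * M * (?D * ?E) = N * ((a * (3 * p + 2 * a)) * (a * (3 * p + 2 * a)))"
    using assms(4) by (simp add: solution_eq_def)
  \<comment> \<open>Expanding, \<open>a * (3 * p + 2 * a)\<close> is at most
    \<open>?D = p^2 + 4 * p * a + 2 * a^2\<close>, and \<open>?D\<close> is at most
    \<open>?E\<close>. As \<open>a > 0\<close>, the positive factor \<open>?D * ?E\<close> then
    cancels.\<close>
  also have "\<dots> \<le> N * (?D * ?E)"
    by (intro mult_left_mono mult_mono) (auto simp: algebra_simps)
  finally have "M * M \<le> N"
    using \<open>a > 0\<close> by simp
  then show "M \<le> N" by (meson le_square le_trans)
qed

text \<open>Lowest terms supply the coprimality that the divisibility argument requires, and
  \<open>s < 1\<close> makes \<open>a = q - p\<close> positive.\<close>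

lemma rational_solution_reduced:
  assumes "s \<in> \<rat>" and "solution N M s"
  obtains p a where "p > 0" "a > 0" "coprime p a" "solution_eq N M p a"
proof -
  from assms(2) have s: "0 < s" "s < 1" "M > 0" by (auto simp: solution_def)
  obtain p q :: nat where pq: "q \<noteq> 0" "\<bar>s\<bar> = real p / real q" "coprime p q"
    using assms(1) by (rule Rats_abs_nat_div_natE)
  have "s = real p / real q" using pq(2) s by simp
  with pq(1) s have "p > 0" "p < q" by (auto intro: Nat.gr0I)
  define a where "a = q - p"
  then have q: "q = p + a" and "a > 0" using \<open>p < q\<close> by auto
  show thesis
  proof (rule that)
    show "coprime p a" using pq(3) by (simp add: q coprime_iff_gcd_eq_1)
    show "solution_eq N M p a"
      using assms(2) pq(2) s solution_iff_solution_eq[OF \<open>p > 0\<close> \<open>a > 0\<close> \<open>M > 0\<close>]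
      by (simp add: q)
  qed fact+
qed

section \<open>The search\<close>

text \<open>The integer \<open>n \<ge> 0\<close> has the code \<open>2 * n\<close> under \<open>int_encode\<close>.\<close>

definition announce :: "nat \<Rightarrow> nat \<Rightarrow> nat \<Rightarrow> nat" where
  "announce M p q = Suc (prod_encode (M, prod_encode (2 * p, 2 * q)))"

lemma decode_announce:
  "decode_output (announce M p q) = Some (M, of_nat p / of_nat q)"
proof -
  have "int_decode (2 * n) = int n" for n
    by (simp add: int_decode_def sum_decode_def)
  then show ?thesis
    by (simp add: announce_def nat_to_rat_surj_def Fract_of_int_quotient)
qed

text \<open>Successors keep \<open>M\<close>, \<open>p\<close> and \<open>a\<close> positive while
  the searches start at 0. Fractions need not be reduced: any hit gives a solution, and lowest terms
  matter only for completeness.\<close>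

definition candidate :: "nat \<Rightarrow> nat \<Rightarrow> nat \<Rightarrow> nat \<Rightarrow> nat" where
  "candidate N m j i =
     (if solution_eq N (Suc m) (Suc i) (Suc j)
      then announce (Suc m) (Suc i) (Suc i + Suc j) else 0)"

text \<open>The bounds come from \<open>solution_eq_bounds\<close>: \<open>M \<le> N\<close>, and
  \<open>p + a \<le> 4 * N\<close> limits both \<open>p\<close> and \<open>a\<close>.\<close>

definition search :: "nat \<Rightarrow> nat" where
  "search N = first_nonzero (\<lambda>m. first_nonzero (\<lambda>j. first_nonzero
     (candidate N m j) (4 * N)) (4 * N)) N"

text \<open>The arguments are listed innermost first, as \<open>i\<close>, \<open>j\<close>,
  \<open>m\<close>, \<open>N\<close>, so that each bounded search removes the head of the
  list.\<close>

lemma computable_search: "computable 1 (\<lambda>xs. search (xs ! 0))"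
proof -
  have cand: "computable 4 (\<lambda>xs. candidate (xs ! 3) (xs ! 2) (xs ! 1) (xs ! 0))"
    unfolding candidate_def announce_def solution_eq_def
    by (intro computable_if_eq computable_prod_encode computable_Suc computable_add
        computable_mult computable_const computable_nth) auto
  have "computable 3 (\<lambda>xs. first_nonzero
      (\<lambda>i. candidate ((i # xs) ! 3) ((i # xs) ! 2) ((i # xs) ! 1) ((i # xs) ! 0)) (4 * xs ! 2))"
    using cand by (intro computable_first_nonzero computable_mult computable_const computable_nth)
      (auto simp: eval_nat_numeral)
  then have "computable 2 (\<lambda>xs. first_nonzero (\<lambda>j. first_nonzero
      (candidate ((j # xs) ! 2) ((j # xs) ! 1) ((j # xs) ! 0)) (4 * (j # xs) ! 2)) (4 * xs ! 1))"
    by (intro computable_first_nonzero[where f =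
          "\<lambda>ys. first_nonzero (candidate (ys ! 2) (ys ! 1) (ys ! 0)) (4 * ys ! 2)"]
        computable_mult computable_const computable_nth)
      (auto simp: eval_nat_numeral)
  then have "computable 1 (\<lambda>xs. first_nonzero (\<lambda>m. first_nonzero (\<lambda>j. first_nonzero
      (candidate ((m # xs) ! 1) ((m # xs) ! 0) j) (4 * (m # xs) ! 1)) (4 * (m # xs) ! 1)) (xs ! 0))"
    by (intro computable_first_nonzero[where f =
          "\<lambda>ys. first_nonzero (\<lambda>j. first_nonzero (candidate (ys ! 1) (ys ! 0) j) (4 * ys ! 1))
             (4 * ys ! 1)"]
        computable_nth)
      (auto simp: eval_nat_numeral)
  then show ?thesis by (simp add: search_def)
qed

lemma search_eq_Suc:
  assumes "search N = Suc k"
  obtains m j i where "solution_eq N (Suc m) (Suc i) (Suc j)"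
    and "search N = announce (Suc m) (Suc i) (Suc i + Suc j)"
proof -
  obtain m j i where "candidate N m j i = Suc k"
    using assms unfolding search_def by (blast dest: first_nonzero_eqD)
  then show thesis
    using assms by (intro that) (auto simp: candidate_def split: if_splits)
qed

lemma search_eq_0:
  assumes "search N = 0" and "m < N" and "j < 4 * N" and "i < 4 * N"
  shows "\<not> solution_eq N (Suc m) (Suc i) (Suc j)"
proof -
  have "candidate N m j i = 0"
    using assms unfolding search_def first_nonzero_eq_0_iff by blast
  then show ?thesis by (auto simp: candidate_def announce_def split: if_splits)
qed

lemma search_correct:
  assumes "N > 0"
  shows "case decode_output (search N) of
           Some (M, s) \<Rightarrow> solution N M (real_of_rat s)
         | None \<Rightarrow> \<not> (\<exists>(M :: nat) (s :: real). s \<in> \<rat> \<and> solution N M s)"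
proof (cases "search N")
  case 0
  have False if rat: "s \<in> \<rat>" and sol: "solution N M s" for M s
  proof -
    obtain p a where pa: "p > 0" "a > 0" "coprime p a" "solution_eq N M p a"
      using rational_solution_reduced[OF rat sol] .
    have "M > 0" using sol by (simp add: solution_def)
    \<comment> \<open>Positivity turns the inclusive bounds into strict ones for the shifted indices
      of \<open>candidate\<close>.\<close>
    then have "M - 1 < N" "a - 1 < 4 * N" "p - 1 < 4 * N"
      using solution_eq_bounds[OF assms pa(2-4)] pa(1,2) by linarith+
    from search_eq_0[OF 0 this] show False
      using pa \<open>M > 0\<close> by simp
  qed
  then show ?thesis by (auto simp: 0)
next
  case (Suc k)
  then obtain m j i where eq: "solution_eq N (Suc m) (Suc i) (Suc j)"
    and out: "search N = announce (Suc m) (Suc i) (Suc i + Suc j)"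
    by (rule search_eq_Suc)
  have "solution N (Suc m) (real (Suc i) / real (Suc i + Suc j))"
    using eq by (subst solution_iff_solution_eq) auto
  then show ?thesis
    by (simp only: out decode_announce option.case prod.case of_rat_divide of_rat_of_nat_eq)
qed

theorem theorem13:
  "\<exists>P :: recf. \<forall>N :: nat. N > 0 \<longrightarrow>
     (\<exists>out. computes P [N] out \<and>
        (case decode_output out of
           Some (M, s) \<Rightarrow> solution N M (real_of_rat s)
         | None \<Rightarrow> \<not> (\<exists>(M :: nat) (s :: real). s \<in> \<rat> \<and> solution N M s)))"
proof -
  obtain P where "\<And>xs. length xs = 1 \<Longrightarrow> computes P xs (search (xs ! 0))"
    using computable_search unfolding computable_def by blast
  then have "computes P [N] (search N)" for N
    by (metis One_nat_def length_Cons list.size(3) nth_Cons_0)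
  then show ?thesis using search_correct by blast
qed

end
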